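(* Let $q$ be a prime power, $n\ge 2$, let $U\subsetneq \mathbb{F}_{q^n}$ be an $\mathbb{F}_q$-vector space of dimension $d_U\ge 1$, and let $G$ be any maximal clique in $G_U$ (a clique not contained in a strictly larger clique), with vertex set $V(G)$. Let $V(G)_2=\{\alpha\in V(G): \alpha^2\in U\}$ and $V(G)_1=V(G)\setminus V(G)_2$. Then: (1) $V(G)_2$ is an $\mathbb{F}_q$-vector space; (2) the elements of $V(G)_1$ are $\mathbb{F}_q$-linearly independent; (3) if $V(G)_1$ is nonempty and $W$ is the $\mathbb{F}_q$-vector space spanned by $V(G)_1$, then $W\cap V(G)_2=\{0\}$. In particular, $\omega(G_U)=q^t+r$ for some integers $t,r\ge 0$ such that either $t=0$ and $r\le d_U+1$, or $t\ge 1$ and $r+t\le d_U$.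
   Context: $\mathbb{F}_{q^n}$ is regarded as an $n$-dimensional vector space over $\mathbb{F}_q$. For an $\mathbb{F}_q$-vector subspace $U\subsetneq \mathbb{F}_{q^n}$, $G_U$ is the undirected graph with vertex set $\mathbb{F}_{q^n}$ in which distinct $a,b$ are adjacent if and only if $ab\in U$; $d_U$ is the $\mathbb{F}_q$-dimension of $U$ and $\omega(G_U)$ is the clique number of $G_U$. *)

theory Defs
  imports
    "HOL-Algebra.Embedded_Algebras"
    "HOL-Library.Ramsey"
    "HOL-Number_Theory.Prime_Powers"
begin

text \<open>
  The library locale \<open>subalgebra K V R\<close> says that \<open>V\<close> is an additive subgroup of \<open>R\<close> closed under
  multiplication by scalars from \<open>K\<close>; despite its name, it does not ask for closure under products,
  so it expresses that \<open>V\<close> is a \<open>K\<close>-vector subspace of \<open>R\<close>.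

  The library notions \<open>ring.Span\<close> and \<open>ring.independent\<close> are about lists of vectors. The two
  definitions below are the corresponding notions for arbitrary sets of vectors.
\<close>

definition set_span :: "('a, 'b) ring_scheme \<Rightarrow> 'a set \<Rightarrow> 'a set \<Rightarrow> 'a set" where
  "set_span R K S = (\<Union>us\<in>{us. set us \<subseteq> S}. ring.Span R K us)"

definition set_independent :: "('a, 'b) ring_scheme \<Rightarrow> 'a set \<Rightarrow> 'a set \<Rightarrow> bool" where
  "set_independent R K S \<longleftrightarrow> (\<forall>us. distinct us \<and> set us \<subseteq> S \<longrightarrow> ring.independent R K us)"

text \<open>
  Undirected graphs are given by a vertex set \<open>V\<close> and a set \<open>E\<close> of two-element sets of vertices,
  as for the library predicate \<open>clique\<close>, which does not itself bound the clique by \<open>V\<close>.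
\<close>

definition maximal_clique :: "'a set \<Rightarrow> 'a set set \<Rightarrow> 'a set \<Rightarrow> bool" where
  "maximal_clique V E C \<longleftrightarrow>
     C \<subseteq> V \<and> clique C E \<and> \<not> (\<exists>D. D \<subseteq> V \<and> clique D E \<and> C \<subset> D)"

definition clique_number :: "'a set \<Rightarrow> 'a set set \<Rightarrow> nat" where
  "clique_number V E = Max (card ` {C. C \<subseteq> V \<and> clique C E})"

definition product_edges :: "('a, 'b) ring_scheme \<Rightarrow> 'a set \<Rightarrow> 'a set set" where
  "product_edges R U =
     {{a, b} | a b. a \<in> carrier R \<and> b \<in> carrier R \<and> a \<noteq> b \<and> a \<otimes>\<^bsub>R\<^esub> b \<in> U}"

end

theory Submission
  imports Defs
begin

text \<open>
  For a fixed vector \<open>u\<close> the set of all \<open>x\<close> with \<open>u x \<in> U\<close> is a subspace. If \<open>u\<close> is a clique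
  vertex with \<open>u\<^sup>2 \<notin> U\<close>, this subspace contains every other vertex of the clique but not \<open>u\<close>;
  hence \<open>V\<^sub>1\<close> is linearly independent modulo \<open>V\<^sub>2\<close>, which is a subspace by maximality of the clique.
  For the clique number, let \<open>t = dim V\<^sub>2\<close> and \<open>r = card V\<^sub>1\<close>. If \<open>t \<ge> 1\<close>, multiplication by a
  nonzero element of \<open>V\<^sub>2\<close> carries \<open>t + r\<close> independent vectors into \<open>U\<close>. If \<open>t = 0\<close>, multiplication
  by an element of \<open>V\<^sub>1\<close> carries the other \<open>r - 1\<close> elements of \<open>V\<^sub>1\<close> into \<open>U\<close>.
\<close>

section \<open>Linear algebra: sizes of spans, bases of finite subspaces, scaling of independent
  lists\<close>

context ring
begin

text \<open>Coefficient lists of length \<open>length us\<close> are coordinates: taking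
  combinations is a bijection from them onto the span, injective by uniqueness of the decomposition.
  This turns \<open>V2\<close> into the term \<open>card K ^ t\<close> of the clique number.\<close>

lemma card_Span_independent:
  assumes "subfield K R" and "independent K us"
  shows "card (Span K us) = card K ^ length us"
proof -
  let ?A = "{ks. set ks \<subseteq> K \<and> length ks = length us}"
  note us = independent_in_carrier[OF assms(2)]
  have image: "(\<lambda>ks. combine ks us) ` ?A = Span K us"
    by (subst Span_eq_combine_set_length_version[OF assms(1) us]) auto
  have "bij_betw (\<lambda>ks. combine ks us) ?A (Span K us)"
    unfolding bij_betw_def
  proof (intro conjI image inj_onI)
    fix ks ls
    assume ks: "ks \<in> ?A" and ls: "ls \<in> ?A" and eq: "combine ks us = combine ls us"
    let ?P = "\<lambda>ms. set ms \<subseteq> K \<and> length ms = length us \<and> combine ks us = combine ms us"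
    have "combine ks us \<in> Span K us"
      by (subst image[symmetric]) (rule imageI[OF ks])
    then have unique: "\<exists>!ms. ?P ms"
      by (rule unique_decomposition[OF assms])
    have "?P ks" using ks by simp
    moreover have "?P ls" using ls eq by simp
    ultimately show "ks = ls"
      by (rule trans[OF sym[OF the1_equality[OF unique]] the1_equality[OF unique]])
  qed
  then have "card (Span K us) = card ?A"
    by (rule bij_betw_same_card[symmetric])
  also have "\<dots> = card K ^ length us"
  proof (cases "finite K")
    case True
    then show ?thesis by (rule card_lists_length_eq)
  next
    \<comment> \<open>Here \<open>card K\<close> is 0 by convention. Both sides are 1 if
      \<open>us\<close> is empty; otherwise both are 0, because the constant lists embed
      \<open>K\<close> into the set of coefficient lists.\<close>
    case False
    show ?thesis
    proof (cases us)
      case Nil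
      have "?A = {[]}" using Nil by auto
      then show ?thesis using Nil by simp
    next
      case (Cons u us')
      have "inj_on (\<lambda>k. replicate (length us) k) K"
        using Cons by (intro inj_onI) auto
      moreover have "(\<lambda>k. replicate (length us) k) ` K \<subseteq> ?A"
        by auto
      ultimately have "infinite ?A"
        using False finite_imageD[of "\<lambda>k. replicate (length us) k" K] finite_subset by blast
      then show ?thesis using False Cons by simp
    qed
  qed
  finally show ?thesis .
qed

text \<open>A list of all elements of \<open>V\<close> spans \<open>V\<close>, and a base can be
  filtered out of any spanning list.\<close>

lemma finite_subalgebra_base:
  assumes "subfield K R" and "subalgebra K V R" and "finite V"
  obtains us where "independent K us" and "Span K us = V"
proof -
  obtain vs where vs: "set vs = V"
    using finite_list[OF assms(3)] by blast
  have carr: "set vs \<subseteq> carrier R"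
    using subalgebra_in_carrier[OF assms(2)] vs by simp
  have span: "Span K vs = V"
    using subalgebra_Span_incl[OF assms(1,2)] Span_base_incl[OF assms(1) carr] vs by blast
  obtain us where "independent K us" and "Span K us = Span K vs"
    using filter_base[OF assms(1) carr] .
  with span show thesis
    by (intro that[of us]) (simp_all only:)
qed

end

text \<open>The factor \<open>a\<close> can be pulled out of a vanishing combination and cancelled
  in a domain. This lets independent lists be moved into \<open>U\<close>, whose dimension then
  bounds their length.\<close>

lemma (in domain) independent_map_mult:
  assumes "subfield K R" and "independent K us" and "a \<in> carrier R" and "a \<noteq> \<zero>"
  shows "independent K (map (\<lambda>u. u \<otimes> a) us)"
proof (rule trivial_combine_imp_independent[OF assms(1)])
  note us = independent_in_carrier[OF assms(2)]
  show "set (map (\<lambda>u. u \<otimes> a) us) \<subseteq> carrier R"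
    using us assms(3) by auto
  fix ks assume ks: "set ks \<subseteq> K" "combine ks (map (\<lambda>u. u \<otimes> a) us) = \<zero>"
  have kc: "set ks \<subseteq> carrier R"
    using ks(1) subfieldE(3)[OF assms(1)] by blast
  have "combine ks us \<otimes> a = \<zero>"
    using ks(2) combine_l_distr[OF kc us assms(3)] by simp
  then have "combine ks us = \<zero>"
    using integral_iff[OF combine_in_carrier[OF kc us] assms(3)] assms(4) by blast
  then show "set (take (length (map (\<lambda>u. u \<otimes> a) us)) ks) \<subseteq> {\<zero>}"
    using independent_imp_trivial_combine[OF assms(1,2) ks(1)] by simp
qed

text \<open>A clique of largest size is maximal under inclusion, since a strictly larger finite
  clique would have more elements. So a statement about all maximal cliques applies to the clique
  number.\<close>

lemma clique_number_attained:
  assumes "finite V"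
  obtains C where "maximal_clique V E C" and "card C = clique_number V E"
proof -
  define S where "S = {C. C \<subseteq> V \<and> clique C E}"
  have number: "clique_number V E = Max (card ` S)"
    unfolding S_def clique_number_def ..
  have "S \<subseteq> Pow V"
    unfolding S_def by blast
  then have fin: "finite (card ` S)"
    using assms by (simp add: finite_subset)
  have "{} \<in> S"
    unfolding S_def by simp
  then have "Max (card ` S) \<in> card ` S"
    by (intro Max_in fin) blast
  then obtain C where C: "C \<in> S" "Max (card ` S) = card C"
    by (rule imageE)
  have "\<not> C \<subset> D" if "D \<in> S" for D
  proof
    assume "C \<subset> D"
    moreover have "finite D"
      using that assms finite_subset[of D V] unfolding S_def by simp
    ultimately have "card C < card D"
      by (intro psubset_card_mono)
    moreover have "card D \<le> card C"
      using Max_ge[OF fin imageI[OF that]] C(2) by simp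
    ultimately show False by simp
  qed
  then have "maximal_clique V E C"
    using C(1) unfolding maximal_clique_def S_def by simp
  then show thesis
    using C(2) number by (intro that) simp_all
qed

section \<open>The graph of products lying in a subspace\<close>

locale product_graph = field +
  fixes K U :: "'a set"
  assumes subfield_K: "subfield K R" and subalgebra_U: "subalgebra K U R"
begin

lemma U_zero: "\<zero> \<in> U"
  using subgroup.one_closed[OF subalgebra.axioms(1)[OF subalgebra_U]] by simp

lemma U_add: "x \<in> U \<Longrightarrow> y \<in> U \<Longrightarrow> x \<oplus> y \<in> U"
  using subgroup.m_closed[OF subalgebra.axioms(1)[OF subalgebra_U]] by simp

lemma U_smult: "k \<in> K \<Longrightarrow> x \<in> U \<Longrightarrow> k \<otimes> x \<in> U"
  using subalgebra.smult_closed[OF subalgebra_U] .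

lemma K_carrier: "k \<in> K \<Longrightarrow> k \<in> carrier R"
  using subfieldE(3)[OF subfield_K] by blast

lemma subalgebraI_smult:
  assumes "V \<subseteq> carrier R" and "\<zero> \<in> V"
    and "\<And>x y. x \<in> V \<Longrightarrow> y \<in> V \<Longrightarrow> x \<oplus> y \<in> V"
    and "\<And>k x. k \<in> K \<Longrightarrow> x \<in> V \<Longrightarrow> k \<otimes> x \<in> V"
  shows "subalgebra K V R"
proof -
  \<comment> \<open>Additive inverses are multiples by the scalar -1, so they come for free from
    closure under scalars.\<close>
  have "\<ominus> \<one> \<in> K"
    using subringE(3,5)[OF subfieldE(1)[OF subfield_K]] by blast
  then have "\<ominus> x \<in> V" if "x \<in> V" for x
    using assms(4)[of "\<ominus> \<one>" x] assms(1) that by (auto simp: l_minus)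
  then have "subgroup V (add_monoid R)"
    using assms(1-3) by (intro add.subgroupI) auto
  then show ?thesis
    using assms(4) by (simp add: subalgebra_def subalgebra_axioms_def)
qed

lemma subalgebra_colon:
  assumes "u \<in> carrier R"
  shows "subalgebra K {x \<in> carrier R. u \<otimes> x \<in> U} R"
proof (rule subalgebraI_smult)
  fix k x assume "k \<in> K" "x \<in> {x \<in> carrier R. u \<otimes> x \<in> U}"
  then show "k \<otimes> x \<in> {x \<in> carrier R. u \<otimes> x \<in> U}"
    using U_smult[of k "u \<otimes> x"] assms by (simp add: K_carrier m_lcomm)
qed (use assms in \<open>auto simp: U_zero U_add r_distr\<close>)

lemma product_edges_iff:
  "{a, b} \<in> product_edges R U \<longleftrightarrow>
     a \<in> carrier R \<and> b \<in> carrier R \<and> a \<noteq> b \<and> a \<otimes> b \<in> U"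
  unfolding product_edges_def by (auto simp: doubleton_eq_iff m_comm)

end

section \<open>Structure of a maximal clique\<close>

locale product_graph_maximal_clique = product_graph +
  fixes C
  assumes maximal: "maximal_clique (carrier R) (product_edges R U) C"
begin

definition "V2 = {\<alpha> \<in> C. \<alpha> [^] (2::nat) \<in> U}"

definition "V1 = C - V2"

lemma C_carrier: "x \<in> C \<Longrightarrow> x \<in> carrier R"
  using maximal unfolding maximal_clique_def by blast

lemma C_mult: "x \<in> C \<Longrightarrow> y \<in> C \<Longrightarrow> x \<noteq> y \<Longrightarrow> x \<otimes> y \<in> U"
  using maximal unfolding maximal_clique_def clique_def product_edges_iff by blast

lemma V2_iff: "x \<in> V2 \<longleftrightarrow> x \<in> C \<and> x \<otimes> x \<in> U"
  unfolding V2_def by (auto simp: numeral_2_eq_2 C_carrier)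

lemma V1_iff: "x \<in> V1 \<longleftrightarrow> x \<in> C \<and> x \<otimes> x \<notin> U"
  unfolding V1_def by (auto simp: V2_iff)

text \<open>Otherwise \<open>insert x C\<close> would be a strictly larger clique.\<close>

lemma C_memI:
  assumes "x \<in> carrier R" and "\<And>y. y \<in> C \<Longrightarrow> x \<otimes> y \<in> U"
  shows "x \<in> C"
proof (rule ccontr)
  assume "x \<notin> C"
  have "clique (insert x C) (product_edges R U)"
    unfolding clique_def product_edges_iff
    using assms C_carrier C_mult by (auto simp: m_comm)
  then show False
    using maximal \<open>x \<notin> C\<close> assms(1) C_carrier unfolding maximal_clique_def by blast
qed

lemma V2_mult: "x \<in> V2 \<Longrightarrow> y \<in> C \<Longrightarrow> x \<otimes> y \<in> U"
  using C_mult V2_iff by blast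

text \<open>\<open>V2\<close> consists exactly of those \<open>x\<close> that multiply every element
  of \<open>C\<close> into \<open>U\<close>, a condition that is linear in \<open>x\<close>.\<close>

lemma subalgebra_V2: "subalgebra K V2 R"
proof (rule subalgebraI_smult)
  \<comment> \<open>Maximality puts \<open>x\<close> into \<open>C\<close>, so the hypothesis may be
    applied to \<open>x\<close> itself and gives \<open>x \<otimes> x \<in> U\<close>.\<close>
  have V2_memI: "x \<in> V2"
    if "x \<in> carrier R" "\<And>y. y \<in> C \<Longrightarrow> x \<otimes> y \<in> U" for x
    using that C_memI[OF that] by (simp add: V2_iff)
  show "V2 \<subseteq> carrier R"
    using C_carrier V2_iff by blast
  show "\<zero> \<in> V2"
    by (rule V2_memI) (simp_all add: C_carrier U_zero)
  show "x \<oplus> y \<in> V2" if "x \<in> V2" "y \<in> V2" for x y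
  proof (rule V2_memI)
    show "x \<oplus> y \<in> carrier R" using that by (simp add: V2_iff C_carrier)
    show "(x \<oplus> y) \<otimes> z \<in> U" if "z \<in> C" for z
      using U_add[OF V2_mult V2_mult, OF \<open>x \<in> V2\<close> that \<open>y \<in> V2\<close> that] \<open>x \<in> V2\<close> \<open>y \<in> V2\<close> that
      by (simp add: V2_iff C_carrier l_distr)
  qed
  show "k \<otimes> x \<in> V2" if "k \<in> K" "x \<in> V2" for k x
  proof (rule V2_memI)
    show "k \<otimes> x \<in> carrier R" using that by (simp add: V2_iff C_carrier K_carrier)
    show "(k \<otimes> x) \<otimes> z \<in> U" if "z \<in> C" for z
      using U_smult[OF \<open>k \<in> K\<close> V2_mult, OF \<open>x \<in> V2\<close> that] \<open>k \<in> K\<close> \<open>x \<in> V2\<close> that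
      by (simp add: V2_iff C_carrier K_carrier m_assoc)
  qed
qed

lemma zero_in_V2: "\<zero> \<in> V2"
  using subgroup.one_closed[OF subalgebra.axioms(1)[OF subalgebra_V2]] by simp

text \<open>The list \<open>vs\<close> is left arbitrary for two uses: the empty list gives
  independence of \<open>V1\<close>, and a base of \<open>V2\<close> gives independence of
  \<open>V1\<close> modulo \<open>V2\<close>.\<close>

lemma independent_V1_append:
  assumes "distinct us" and "set us \<subseteq> V1" and "independent K vs" and "set vs \<subseteq> V2"
  shows "independent K (us @ vs)"
  using assms(1,2)
proof (induction us)
  case Nil
  then show ?case using assms(3) by simp
next
  case (Cons u us)
  then have u: "u \<in> C" "u \<otimes> u \<notin> U"
    by (auto simp: V1_iff)
  \<comment> \<open>Adjacency requires \<open>u \<noteq> x\<close>: for \<open>us\<close> this is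
    distinctness, and for \<open>vs\<close> it holds because squares of elements of
    \<open>V2\<close> lie in \<open>U\<close> while that of \<open>u\<close> does not.\<close>
  have "u \<otimes> x \<in> U" if "x \<in> set (us @ vs)" for x
    using that Cons.prems assms(4) u by (intro C_mult) (auto simp: V1_iff V2_iff)
  moreover have "x \<in> carrier R" if "x \<in> set (us @ vs)" for x
    using that Cons.prems assms(4) by (auto simp: V1_iff V2_iff C_carrier)
  ultimately have "Span K (us @ vs) \<subseteq> {x \<in> carrier R. u \<otimes> x \<in> U}"
    using u by (intro subalgebra_Span_incl subfield_K subalgebra_colon) (auto simp: C_carrier)
  then have "u \<notin> Span K (us @ vs)"
    using u(2) by blast
  then show ?case
    using Cons u by (auto intro!: li_Cons simp: C_carrier simp del: Span.simps)
qed

lemma set_independent_V1: "set_independent R K V1"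
  unfolding set_independent_def using independent_V1_append[of _ "[]"] by auto

lemma set_span_V1_inter_V2:
  assumes "finite V2"
  shows "set_span R K V1 \<inter> V2 = {\<zero>}"
proof -
  obtain vs where vs: "independent K vs" "Span K vs = V2"
    using finite_subalgebra_base[OF subfield_K subalgebra_V2 assms] by blast
  have vs2: "set vs \<subseteq> V2"
    using Span_base_incl[OF subfield_K independent_in_carrier[OF vs(1)]] vs(2) by simp
  have "Span K us \<inter> V2 = {\<zero>}" if "set us \<subseteq> V1" for us
  proof -
    \<comment> \<open>Lists in \<open>set_span\<close> may repeat vectors; removing repetitions
      leaves the span unchanged and makes the list independent.\<close>
    have "independent K (remdups us @ vs)"
      using that by (intro independent_V1_append vs vs2) auto
    then have "Span K (remdups us) \<inter> V2 = {\<zero>}"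
      using independent_split(3)[OF subfield_K] vs(2) by blast
    moreover have "set us \<subseteq> carrier R"
      using that by (auto simp: V1_iff C_carrier)
    ultimately show ?thesis
      using Span_same_set[OF subfield_K, of us "remdups us"] by (metis set_remdups)
  qed
  \<comment> \<open>The union defining \<open>set_span\<close> must be nonempty for it to contain
    zero.\<close>
  moreover have "\<exists>us. set us \<subseteq> V1"
    by (intro exI[of _ "[]"]) simp
  ultimately show ?thesis
    unfolding set_span_def by blast
qed

section \<open>Counting the vertices of a maximal clique\<close>

lemma card_C:
  assumes "finite (carrier R)" and "dimension d K U"
  shows "\<exists>t r. card C = card K ^ t + r \<and> (t = 0 \<and> r \<le> d + 1 \<or> t \<ge> 1 \<and> r + t \<le> d)"
proof -
  have finC: "finite C"
    using assms(1) C_carrier by (meson finite_subset subsetI)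
  then have fin: "finite V1" "finite V2"
    by (simp_all add: V1_def V2_def)
  obtain vs where vs: "independent K vs" "Span K vs = V2"
    using finite_subalgebra_base[OF subfield_K subalgebra_V2 fin(2)] by blast
  have vs2: "set vs \<subseteq> V2"
    using Span_base_incl[OF subfield_K independent_in_carrier[OF vs(1)]] vs(2) by simp
  \<comment> \<open>Multiplication by \<open>a\<close> sends \<open>ws\<close> to an independent
    list inside \<open>U\<close>.\<close>
  have le_d: "length ws \<le> d"
    if "independent K ws" "a \<in> carrier R" "a \<noteq> \<zero>" "\<And>x. x \<in> set ws \<Longrightarrow> x \<otimes> a \<in> U" for ws a
    using independent_length_le_dimension[OF subfield_K assms(2)
        independent_map_mult[OF subfield_K that(1-3)]] that(4) by auto
  have "card C = card V2 + card V1"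
    using finC fin(2) card_Diff_subset[of V2 C] card_mono[of C V2]
    by (auto simp: V1_def V2_def)
  also have "card V2 = card K ^ length vs"
    using card_Span_independent[OF subfield_K vs(1)] vs(2) by simp
  finally have card: "card C = card K ^ length vs + card V1" .
  show ?thesis
  proof (cases vs)
    case Nil
    \<comment> \<open>The extra 1 accounts for the multiplier \<open>v\<close>, which must be left
      out of the list because \<open>v \<otimes> v \<notin> U\<close>.\<close>
    have "card V1 \<le> d + 1"
    proof (cases "V1 = {}")
      case False
      then obtain v where v: "v \<in> V1" by blast
      obtain us where us: "distinct us" "set us = V1 - {v}"
        using finite_distinct_list fin(1) by (metis finite_Diff)
      have "length us \<le> d"
      proof (rule le_d)
        show "independent K us"
          using independent_V1_append[OF us(1) _ li_Nil] us(2) by auto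
        show "v \<in> carrier R" using v by (simp add: V1_iff C_carrier)
        show "v \<noteq> \<zero>" using v zero_in_V2 by (auto simp: V1_def)
        show "x \<otimes> v \<in> U" if "x \<in> set us" for x
          using that us(2) v by (intro C_mult) (auto simp: V1_iff)
      qed
      then show ?thesis
        using us v fin(1) distinct_card[OF us(1)] by simp
    qed simp
    then show ?thesis
      using card Nil by (intro exI[of _ 0] exI[of _ "card V1"]) simp
  next
    case (Cons a vs')
    have a: "a \<in> V2" using vs2 Cons by simp
    have "independent K (a # vs')"
      using vs(1) Cons by simp
    \<comment> \<open>The head of an independent list is outside the span of the tail, and that span
      contains zero.\<close>
    then have "a \<noteq> \<zero>"
      using independent_backwards(1,2)[of K a vs']
        Span_subgroup_props(2)[OF subfield_K independent_in_carrier, of K vs'] by blast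
    obtain us where us: "distinct us" "set us = V1"
      using finite_distinct_list fin(1) by blast
    \<comment> \<open>Since \<open>a\<close> lies in \<open>V2\<close>, it multiplies all of
      \<open>C\<close>, itself included, into \<open>U\<close>; no vector has to be dropped.\<close>
    have "length (us @ vs) \<le> d"
    proof (rule le_d)
      show "independent K (us @ vs)"
        using independent_V1_append[OF us(1) _ vs(1) vs2] us(2) by simp
      show "a \<in> carrier R" using a by (simp add: V2_iff C_carrier)
      show "x \<otimes> a \<in> U" if "x \<in> set (us @ vs)" for x
      proof -
        have "x \<in> C" using that us(2) vs2 by (auto simp: V1_iff V2_iff)
        then show ?thesis
          using V2_mult[OF a] m_comm[of x a] a by (simp add: V2_iff C_carrier)
      qed
    qed fact
    then show ?thesis
      using card Cons us distinct_card[OF us(1)]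
      by (intro exI[of _ "length vs"] exI[of _ "card V1"]) simp
  qed
qed

end

theorem theorem3p1:
  fixes L :: "('a, 'b) ring_scheme" and K U :: "'a set" and q n d :: nat
  assumes "primepow q" and "n \<ge> 2"
    and "field L" and "card (carrier L) = q ^ n"
    and "subfield K L" and "card K = q"
    and "subalgebra K U L" and "U \<subset> carrier L"
    and "ring.dimension L d K U" and "d \<ge> 1"
  shows "(\<forall>C. maximal_clique (carrier L) (product_edges L U) C \<longrightarrow>
           (let V2 = {\<alpha> \<in> C. \<alpha> [^]\<^bsub>L\<^esub> (2::nat) \<in> U}; V1 = C - V2 in
              subalgebra K V2 L
              \<and> set_independent L K V1
              \<and> (V1 \<noteq> {} \<longrightarrow> set_span L K V1 \<inter> V2 = {\<zero>\<^bsub>L\<^esub>})))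
         \<and> (\<exists>t r :: nat. clique_number (carrier L) (product_edges L U) = q ^ t + r
              \<and> (t = 0 \<and> r \<le> d + 1 \<or> t \<ge> 1 \<and> r + t \<le> d))"
proof -
  interpret product_graph L K U
    using assms(3,5,7) by (simp add: product_graph_def product_graph_axioms_def)
  have "q > 0" using assms(1) primepow_gt_0_nat by blast
  \<comment> \<open>An infinite carrier would have \<open>card\<close> equal to 0, but
    \<open>q ^ n\<close> is positive.\<close>
  then have fin: "finite (carrier L)"
    using assms(4) card_gt_0_iff by fastforce
  have "let V2 = {\<alpha> \<in> C. \<alpha> [^]\<^bsub>L\<^esub> (2::nat) \<in> U}; V1 = C - V2 in
          subalgebra K V2 L \<and> set_independent L K V1
          \<and> (V1 \<noteq> {} \<longrightarrow> set_span L K V1 \<inter> V2 = {\<zero>\<^bsub>L\<^esub>})"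
    if "maximal_clique (carrier L) (product_edges L U) C" for C
  proof -
    interpret product_graph_maximal_clique L K U C
      by unfold_locales fact
    have "V2 \<subseteq> carrier L"
      using subalgebra_in_carrier[OF subalgebra_V2] .
    then have "finite V2"
      using fin finite_subset by blast
    then show ?thesis
      using subalgebra_V2 set_independent_V1 set_span_V1_inter_V2
      by (simp add: Let_def V1_def V2_def)
  qed
  moreover obtain C where C: "maximal_clique (carrier L) (product_edges L U) C"
    and card: "card C = clique_number (carrier L) (product_edges L U)"
    using clique_number_attained[OF fin] .
  interpret product_graph_maximal_clique L K U C
    by unfold_locales fact
  note card_C[OF fin assms(9), unfolded card assms(6)]
  ultimately show ?thesis by blast
qed

end
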